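(* Let $\mathbf{I}\mathbb{N}_{\infty}$ be the monoid of all partial cofinite isometries of $\mathbb{N}$. For a congruence $\mathfrak{C}$ on $\mathbf{I}\mathbb{N}_{\infty}$ the following conditions are equivalent: (1) $\mathfrak{C}$ is a group congruence on $\mathbf{I}\mathbb{N}_{\infty}$; (2) there exists a subsemigroup $S$ of $\mathbf{I}\mathbb{N}_{\infty}$ which is isomorphic to the bicyclic semigroup and such that some two distinct elements of $S$ are $\mathfrak{C}$-equivalent; (3) for every subsemigroup $T$ of $\mathbf{I}\mathbb{N}_{\infty}$ which is isomorphic to the bicyclic semigroup, some two distinct elements of $T$ are $\mathfrak{C}$-equivalent.
   Context: $\mathbb{N}=\{1,2,3,\ldots\}$ with the metric $d(n,m)=|n-m|$. $\mathbf{I}\mathbb{N}_{\infty}$ is the inverse monoid of all partial maps $\alpha:\mathbb{N}\rightharpoonup\mathbb{N}$ such that $\mathbb{N}\setminus\operatorname{dom}\alpha$ and $\mathbb{N}\setminus\operatorname{ran}\alpha$ are finite and $|(x)\alpha-(y)\alpha|=|x-y|$ for all $x,y\in\operatorname{dom}\alpha$, with composition written left to right: $(x)(\alpha\beta)=((x)\alpha)\beta$, $\operatorname{dom}(\alpha\beta)=\{x\in\operatorname{dom}\alpha:(x)\alpha\in\operatorname{dom}\beta\}$. A congruence $\mathfrak{C}$ on a semigroup $S$ is a group congruence if $S/\mathfrak{C}$ is a group. Elements $a,b$ are $\mathfrak{C}$-equivalent if $(a,b)\in\mathfrak{C}$. The bicyclic semigroup is the monoid generated by $p,q$ subject to the single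 relation $pq=1$. *)

theory Defs
  imports "HOL-Algebra.Group"
begin

definition congruence_on :: "('a, 'b) monoid_scheme \<Rightarrow> ('a \<times> 'a) set \<Rightarrow> bool" where
  "congruence_on G C \<longleftrightarrow> equiv (carrier G) C \<and>
     (\<forall>a a' b b'. (a, a') \<in> C \<longrightarrow> (b, b') \<in> C \<longrightarrow> (a \<otimes>\<^bsub>G\<^esub> b, a' \<otimes>\<^bsub>G\<^esub> b') \<in> C)"

text \<open>For a congruence \<open>C\<close> and classes \<open>A\<close>, \<open>B\<close>, the union below is a single class,
  namely the class of \<open>a \<otimes> b\<close> for any \<open>a \<in> A\<close>, \<open>b \<in> B\<close>.\<close>

definition quotient_monoid :: "('a, 'b) monoid_scheme \<Rightarrow> ('a \<times> 'a) set \<Rightarrow> 'a set monoid" where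
  "quotient_monoid G C =
     \<lparr>carrier = carrier G // C,
      monoid.mult = (\<lambda>A B. \<Union>a\<in>A. \<Union>b\<in>B. C `` {a \<otimes>\<^bsub>G\<^esub> b}),
      one = C `` {\<one>\<^bsub>G\<^esub>}\<rparr>"

definition group_congruence :: "('a, 'b) monoid_scheme \<Rightarrow> ('a \<times> 'a) set \<Rightarrow> bool" where
  "group_congruence G C \<longleftrightarrow> congruence_on G C \<and> group (quotient_monoid G C)"

definition generated_congruence ::
  "('a, 'b) monoid_scheme \<Rightarrow> ('a \<times> 'a) set \<Rightarrow> ('a \<times> 'a) set" where
  "generated_congruence G R = \<Inter> {C. congruence_on G C \<and> R \<subseteq> C}"

definition subsemigroup :: "'a set \<Rightarrow> ('a, 'b) monoid_scheme \<Rightarrow> bool" where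
  "subsemigroup S G \<longleftrightarrow>
     S \<noteq> {} \<and> S \<subseteq> carrier G \<and> (\<forall>a\<in>S. \<forall>b\<in>S. a \<otimes>\<^bsub>G\<^esub> b \<in> S)"

definition free_monoid :: "'a list monoid" where
  "free_monoid = \<lparr>carrier = UNIV, monoid.mult = (@), one = []\<rparr>"

datatype bicyclic_generator = Gen_p | Gen_q

definition bicyclic :: "bicyclic_generator list set monoid" where
  "bicyclic =
     quotient_monoid free_monoid (generated_congruence free_monoid {([Gen_p, Gen_q], [])})"

text \<open>Library isomorphism \<open>\<cong>\<close> only refers to carrier and multiplication, so the unit of \<open>G\<close>
  left in the restricted record (and possibly lying outside \<open>S\<close>) plays no role: this is
  isomorphism of semigroups.\<close>

definition bicyclic_subsemigroup :: "'a set \<Rightarrow> ('a, 'b) monoid_scheme \<Rightarrow> bool" where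
  "bicyclic_subsemigroup S G \<longleftrightarrow> subsemigroup S G \<and> G\<lparr>carrier := S\<rparr> \<cong> bicyclic"

text \<open>The positive integers are the subset \<open>{1..}\<close> of type \<open>nat\<close>. Distances are taken in \<open>int\<close>
  because subtraction on \<open>nat\<close> truncates.\<close>

definition partial_cofinite_isometry :: "(nat \<rightharpoonup> nat) \<Rightarrow> bool" where
  "partial_cofinite_isometry \<alpha> \<longleftrightarrow>
     dom \<alpha> \<subseteq> {1..} \<and> ran \<alpha> \<subseteq> {1..} \<and>
     finite ({1..} - dom \<alpha>) \<and> finite ({1..} - ran \<alpha>) \<and>
     (\<forall>x\<in>dom \<alpha>. \<forall>y\<in>dom \<alpha>.
        \<bar>int (the (\<alpha> x)) - int (the (\<alpha> y))\<bar> = \<bar>int x - int y\<bar>)"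

text \<open>Maps act on the right, so the product \<open>\<alpha>\<beta>\<close> applies \<open>\<alpha>\<close> first.\<close>

definition IN_inf :: "(nat \<rightharpoonup> nat) monoid" where
  "IN_inf =
     \<lparr>carrier = {\<alpha>. partial_cofinite_isometry \<alpha>},
      monoid.mult = (\<lambda>\<alpha> \<beta>. \<beta> \<circ>\<^sub>m \<alpha>),
      one = (Some |` {1..})\<rparr>"

end

theory Submission
  imports Defs
begin

text \<open>
  An isometry defined on a cofinite set of positive integers is the restriction
  \<open>ptrans k D\<close> of a translation \<open>x \<mapsto> x + k\<close> to a cofinite set \<open>D\<close>, because the reflections
  \<open>x \<mapsto> c - x\<close> leave the positive integers far out. The idempotents are the elements with \<open>k = 0\<close>,
  and every element times a suitable one is idempotent; hence a congruence is a group congruence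
  as soon as it identifies all idempotents (\<open>group_congruence_if_idempotents\<close>).

  A group has one idempotent, so a group congruence collapses the two idempotents \<open>1\<close> and \<open>qp\<close> of
  every bicyclic subsemigroup. Bicyclic subsemigroups exist: take the one generated by
  \<open>x \<mapsto> x + 1\<close> and its inverse. This settles the implications from group congruences to all
  bicyclic subsemigroups and from all to some.

  For the remaining implication, let \<open>P\<close>, \<open>Q\<close> be the generators of a bicyclic subsemigroup and \<open>D\<close>
  the domain of its identity. The relation \<open>PQ = 1 \<noteq> QP\<close> forces \<open>P\<close> to be translation of \<open>D\<close> by some
  \<open>d \<noteq> 0\<close> into \<open>D\<close>, and \<open>d > 0\<close> since \<open>D\<close> is bounded below. Then all elements are translations
  of sets \<open>D + i d\<close> (\<open>bicyclic_subsemigroup_structure\<close>). Two distinct elements thus differ in the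
  amount of translation, or in how far out the last gap of their domains lies. In both cases
  sandwiching the equivalence between suitable translations moves the difference to the left end of
  the half-line: it makes the identity equivalent to an idempotent that is undefined at \<open>1\<close>.
  Translating this equivalence repeatedly, the identity becomes equivalent to the identity of each
  \<open>{n..}\<close>, and so to every idempotent (\<open>group_congruence_if_gap\<close>,
  \<open>group_congruence_if_distinct_shift\<close>).
\<close>

section \<open>Quotients by a congruence\<close>

lemma congruence_on_equiv: "congruence_on G C \<Longrightarrow> equiv (carrier G) C"
  by (simp add: congruence_on_def)

lemma congruence_on_mult:
  "congruence_on G C \<Longrightarrow> (a, a') \<in> C \<Longrightarrow> (b, b') \<in> C \<Longrightarrow> (a \<otimes>\<^bsub>G\<^esub> b, a' \<otimes>\<^bsub>G\<^esub> b') \<in> C"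
  unfolding congruence_on_def by blast

lemma congruence_on_refl: "congruence_on G C \<Longrightarrow> a \<in> carrier G \<Longrightarrow> (a, a) \<in> C"
  by (meson congruence_on_equiv equivE refl_onD)

lemma congruence_on_sym: "congruence_on G C \<Longrightarrow> (a, b) \<in> C \<Longrightarrow> (b, a) \<in> C"
  by (meson congruence_on_equiv equivE symD)

lemma congruence_on_trans:
  "congruence_on G C \<Longrightarrow> (a, b) \<in> C \<Longrightarrow> (b, c) \<in> C \<Longrightarrow> (a, c) \<in> C"
  by (meson congruence_on_equiv equivE transD)

lemma congruence_on_sandwich:
  assumes "congruence_on G C" "(a, b) \<in> C" "u \<in> carrier G" "v \<in> carrier G"
  shows "((u \<otimes>\<^bsub>G\<^esub> a) \<otimes>\<^bsub>G\<^esub> v, (u \<otimes>\<^bsub>G\<^esub> b) \<otimes>\<^bsub>G\<^esub> v) \<in> C"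
  using assms by (intro congruence_on_mult[OF assms(1)] congruence_on_refl[OF assms(1)])

lemma quotient_monoid_simps:
  "carrier (quotient_monoid G C) = carrier G // C"
  "\<one>\<^bsub>quotient_monoid G C\<^esub> = C `` {\<one>\<^bsub>G\<^esub>}"
  by (simp_all add: quotient_monoid_def)

lemma quotient_monoid_mult:
  assumes C: "congruence_on G C" and "a \<in> carrier G" "b \<in> carrier G"
  shows "C `` {a} \<otimes>\<^bsub>quotient_monoid G C\<^esub> C `` {b} = C `` {a \<otimes>\<^bsub>G\<^esub> b}"
proof -
  have eq: "C `` {a' \<otimes>\<^bsub>G\<^esub> b'} = C `` {a \<otimes>\<^bsub>G\<^esub> b}" if "(a, a') \<in> C" "(b, b') \<in> C" for a' b'
    using equiv_class_eq[OF congruence_on_equiv[OF C] congruence_on_mult[OF C that]] by simp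
  have "(\<Union>a'\<in>C `` {a}. \<Union>b'\<in>C `` {b}. C `` {a' \<otimes>\<^bsub>G\<^esub> b'}) = C `` {a \<otimes>\<^bsub>G\<^esub> b}"
    (is "?U = _")
  proof
    show "?U \<subseteq> C `` {a \<otimes>\<^bsub>G\<^esub> b}"
      by (intro UN_least) (simp only: Image_singleton_iff eq order_refl)
    have "a \<in> C `` {a}" "b \<in> C `` {b}"
      using congruence_on_refl[OF C] assms(2,3) by simp_all
    then show "C `` {a \<otimes>\<^bsub>G\<^esub> b} \<subseteq> ?U" by blast
  qed
  then show ?thesis by (simp only: quotient_monoid_def monoid.simps)
qed

text \<open>Left inverses modulo \<open>C\<close> suffice: the quotient of a monoid is a monoid, and a monoid with left
  inverses is a group.\<close>

lemma quotient_group_iff: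
  assumes "monoid G" and C: "congruence_on G C"
  shows "group_congruence G C \<longleftrightarrow> (\<forall>a\<in>carrier G. \<exists>b\<in>carrier G. (b \<otimes>\<^bsub>G\<^esub> a, \<one>\<^bsub>G\<^esub>) \<in> C)"
proof -
  interpret monoid G by fact
  let ?Q = "quotient_monoid G C"
  have class_eq: "C `` {a} = C `` {b} \<longleftrightarrow> (a, b) \<in> C" if "a \<in> carrier G" "b \<in> carrier G" for a b
    using eq_equiv_class_iff[OF congruence_on_equiv[OF C] that] .
  have mem: "C `` {a} \<in> carrier ?Q" if "a \<in> carrier G" for a
    using that by (simp add: quotient_monoid_simps quotientI)
  have memE: "\<exists>a\<in>carrier G. X = C `` {a}" if "X \<in> carrier ?Q" for X
    using that unfolding quotient_monoid_simps by (elim quotientE) blast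
  note mult = quotient_monoid_mult[OF C]
  have "group ?Q" if inv: "\<forall>a\<in>carrier G. \<exists>b\<in>carrier G. (b \<otimes>\<^bsub>G\<^esub> a, \<one>\<^bsub>G\<^esub>) \<in> C"
  proof (rule groupI)
    fix X assume "X \<in> carrier ?Q"
    then obtain a where a: "a \<in> carrier G" "X = C `` {a}" using memE by blast
    show "\<one>\<^bsub>?Q\<^esub> \<otimes>\<^bsub>?Q\<^esub> X = X"
      using a by (simp add: quotient_monoid_simps mult)
    obtain b where b: "b \<in> carrier G" "(b \<otimes>\<^bsub>G\<^esub> a, \<one>\<^bsub>G\<^esub>) \<in> C" using inv a by blast
    have "C `` {b} \<otimes>\<^bsub>?Q\<^esub> X = \<one>\<^bsub>?Q\<^esub>"
      using a b by (simp add: mult quotient_monoid_simps class_eq)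
    then show "\<exists>Y\<in>carrier ?Q. Y \<otimes>\<^bsub>?Q\<^esub> X = \<one>\<^bsub>?Q\<^esub>" using mem[OF b(1)] by blast
    fix Y assume "Y \<in> carrier ?Q"
    then obtain b where b: "b \<in> carrier G" "Y = C `` {b}" using memE by blast
    show "X \<otimes>\<^bsub>?Q\<^esub> Y \<in> carrier ?Q"
      using a b by (simp add: mult mem)
    fix Z assume "Z \<in> carrier ?Q"
    then obtain c where c: "c \<in> carrier G" "Z = C `` {c}" using memE by blast
    show "(X \<otimes>\<^bsub>?Q\<^esub> Y) \<otimes>\<^bsub>?Q\<^esub> Z = X \<otimes>\<^bsub>?Q\<^esub> (Y \<otimes>\<^bsub>?Q\<^esub> Z)"
      using a b c by (simp add: mult m_assoc)
  qed (simp add: quotient_monoid_simps quotientI)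
  moreover have "\<exists>b\<in>carrier G. (b \<otimes>\<^bsub>G\<^esub> a, \<one>\<^bsub>G\<^esub>) \<in> C" if grp: "group ?Q" and a: "a \<in> carrier G" for a
  proof -
    interpret Q: group ?Q by (rule grp)
    obtain X where X: "X \<in> carrier ?Q" "X \<otimes>\<^bsub>?Q\<^esub> C `` {a} = \<one>\<^bsub>?Q\<^esub>"
      using Q.l_inv_ex[OF mem[OF a]] by blast
    then obtain b where b: "b \<in> carrier G" "X = C `` {b}"
      using memE by blast
    have "C `` {b \<otimes>\<^bsub>G\<^esub> a} = C `` {\<one>\<^bsub>G\<^esub>}"
      using X(2) b a by (simp add: quotient_monoid_mult[OF C] quotient_monoid_simps)
    then show ?thesis using b a class_eq[of "b \<otimes>\<^bsub>G\<^esub> a" "\<one>\<^bsub>G\<^esub>"] by blast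
  qed
  ultimately have "group ?Q \<longleftrightarrow> (\<forall>a\<in>carrier G. \<exists>b\<in>carrier G. (b \<otimes>\<^bsub>G\<^esub> a, \<one>\<^bsub>G\<^esub>) \<in> C)"
    by metis
  then show ?thesis using C by (simp add: group_congruence_def)
qed

lemma group_congruence_idempotent:
  assumes "monoid G" "group_congruence G C" "e \<in> carrier G" "e \<otimes>\<^bsub>G\<^esub> e = e"
  shows "(e, \<one>\<^bsub>G\<^esub>) \<in> C"
proof -
  interpret monoid G by fact
  have C: "congruence_on G C" using assms(2) by (simp add: group_congruence_def)
  obtain b where b: "b \<in> carrier G" "(b \<otimes>\<^bsub>G\<^esub> e, \<one>\<^bsub>G\<^esub>) \<in> C"
    using quotient_group_iff[OF assms(1) C] assms(2,3) by blast
  have "(b \<otimes>\<^bsub>G\<^esub> e \<otimes>\<^bsub>G\<^esub> e, \<one>\<^bsub>G\<^esub> \<otimes>\<^bsub>G\<^esub> e) \<in> C"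
    by (rule congruence_on_mult[OF C b(2) congruence_on_refl[OF C assms(3)]])
  then have "(e, b \<otimes>\<^bsub>G\<^esub> e) \<in> C"
    using b assms(3,4) by (subst (asm) m_assoc) (simp_all add: congruence_on_sym[OF C])
  then show ?thesis using b(2) by (rule congruence_on_trans[OF C])
qed

section \<open>The bicyclic semigroup\<close>

lemma free_monoid_simps [simp]:
  "carrier free_monoid = UNIV" "u \<otimes>\<^bsub>free_monoid\<^esub> v = u @ v" "\<one>\<^bsub>free_monoid\<^esub> = []"
  by (simp_all add: free_monoid_def)

lemma generated_congruence_is_congruence:
  assumes "monoid G" "R \<subseteq> carrier G \<times> carrier G"
  shows "congruence_on G (generated_congruence G R)"
proof -
  interpret monoid G by fact
  have all: "congruence_on G (carrier G \<times> carrier G)"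
    unfolding congruence_on_def by (auto simp: equiv_def refl_on_def sym_def trans_def)
  let ?g = "generated_congruence G R"
  have genI: "(a, b) \<in> ?g" if "\<And>C. congruence_on G C \<Longrightarrow> R \<subseteq> C \<Longrightarrow> (a, b) \<in> C" for a b
    unfolding generated_congruence_def using that by simp
  have genD: "(a, b) \<in> C" if "(a, b) \<in> ?g" "congruence_on G C" "R \<subseteq> C" for a b C
    using that unfolding generated_congruence_def by simp
  have "?g \<subseteq> carrier G \<times> carrier G"
    unfolding generated_congruence_def by (rule Inter_lower) (simp add: all assms(2))
  moreover have "(a, a) \<in> ?g" if "a \<in> carrier G" for a
    by (rule genI) (rule congruence_on_refl[OF _ that])
  moreover have "(b, a) \<in> ?g" if ab: "(a, b) \<in> ?g" for a b
    by (rule genI, rule congruence_on_sym) (use genD[OF ab] in blast)+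
  moreover have "(a, c) \<in> ?g" if ab: "(a, b) \<in> ?g" and bc: "(b, c) \<in> ?g" for a b c
    by (rule genI, rule congruence_on_trans[where b = b]) (use genD[OF ab] genD[OF bc] in blast)+
  ultimately have "equiv (carrier G) ?g"
    unfolding equiv_def refl_on_def sym_def trans_def by (intro conjI allI ballI impI)
  moreover have "(a \<otimes>\<^bsub>G\<^esub> b, a' \<otimes>\<^bsub>G\<^esub> b') \<in> ?g"
    if aa: "(a, a') \<in> ?g" and bb: "(b, b') \<in> ?g" for a a' b b'
    by (rule genI, rule congruence_on_mult) (use genD[OF aa] genD[OF bb] in blast)+
  ultimately show ?thesis
    unfolding congruence_on_def[of G ?g] by (intro conjI allI impI)
qed

definition bicyclic_relation :: "(bicyclic_generator list \<times> bicyclic_generator list) set" where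
  "bicyclic_relation = generated_congruence free_monoid {([Gen_p, Gen_q], [])}"

lemma bicyclic_relation_congruence: "congruence_on free_monoid bicyclic_relation"
proof -
  have "monoid (free_monoid :: bicyclic_generator list monoid)" by unfold_locales auto
  then show ?thesis
    unfolding bicyclic_relation_def by (intro generated_congruence_is_congruence) auto
qed

lemma bicyclic_relation_append:
  "(u, u') \<in> bicyclic_relation \<Longrightarrow> (v, v') \<in> bicyclic_relation \<Longrightarrow>
     (u @ v, u' @ v') \<in> bicyclic_relation"
  using congruence_on_mult[OF bicyclic_relation_congruence] by fastforce

lemma bicyclic_relation_refl: "(u, u) \<in> bicyclic_relation"
  using congruence_on_refl[OF bicyclic_relation_congruence] by simp

lemma bicyclic_relation_pq: "([Gen_p, Gen_q], []) \<in> bicyclic_relation"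
  unfolding bicyclic_relation_def generated_congruence_def by blast

text \<open>The equality kernel of a multiplicative map is a congruence, so it contains the generated one as
  soon as it contains the defining relation.\<close>

lemma bicyclic_relation_least:
  fixes h :: "bicyclic_generator list \<Rightarrow> 'a"
  assumes "\<And>u v. h (u @ v) = h u \<otimes>\<^bsub>G\<^esub> h v" "h [Gen_p, Gen_q] = h []"
    and "(u, v) \<in> bicyclic_relation"
  shows "h u = h v"
proof -
  have "congruence_on free_monoid {(u, v). h u = h v}"
    unfolding congruence_on_def using assms(1)
    by (auto simp: equiv_def refl_on_def sym_def trans_def)
  then show ?thesis
    using assms(2,3) unfolding bicyclic_relation_def generated_congruence_def by blast
qed

text \<open>Prefixing \<open>q\<close> to \<open>q\<^sup>i p\<^sup>j\<close> lengthens the block of \<open>q\<close>'s; prefixing \<open>p\<close> cancels one \<open>q\<close>, or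
  lengthens the block of \<open>p\<close>'s if there is no \<open>q\<close>.\<close>

lemma bicyclic_normal_form:
  "\<exists>i j. (w, replicate i Gen_q @ replicate j Gen_p) \<in> bicyclic_relation"
proof (induction w)
  case Nil
  then show ?case using bicyclic_relation_refl[of "[]"] by (metis append_Nil replicate_0)
next
  case (Cons g w)
  then obtain i j where ij: "(w, replicate i Gen_q @ replicate j Gen_p) \<in> bicyclic_relation"
    by blast
  have *: "(g # w, [g] @ replicate i Gen_q @ replicate j Gen_p) \<in> bicyclic_relation"
    using bicyclic_relation_append[OF bicyclic_relation_refl[of "[g]"] ij] by simp
  show ?case
  proof (cases g)
    case Gen_q
    then show ?thesis using * by (intro exI[of _ "Suc i"] exI[of _ j]) simp
  next
    case g: Gen_p
    show ?thesis
    proof (cases i)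
      case 0
      then show ?thesis using * g by (intro exI[of _ 0] exI[of _ "Suc j"]) simp
    next
      case (Suc i')
      have "([Gen_p, Gen_q] @ replicate i' Gen_q @ replicate j Gen_p,
             [] @ replicate i' Gen_q @ replicate j Gen_p) \<in> bicyclic_relation"
        by (rule bicyclic_relation_append[OF bicyclic_relation_pq bicyclic_relation_refl])
      then show ?thesis
        using * g Suc congruence_on_trans[OF bicyclic_relation_congruence *]
        by (intro exI[of _ i'] exI[of _ j]) simp
    qed
  qed
qed

text \<open>A bicyclic subsemigroup is the same as an evaluation of words in \<open>p\<close>, \<open>q\<close> whose kernel is the
  bicyclic congruence. In this form its elements can be treated by induction on words, and a
  concrete copy is given by its two generators.\<close>

lemma bicyclic_subsemigroup_iff:
  "bicyclic_subsemigroup S G \<longleftrightarrow>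
     S \<subseteq> carrier G \<and>
     (\<exists>h. range h = S \<and> (\<forall>u v. h (u @ v) = h u \<otimes>\<^bsub>G\<^esub> h v) \<and>
          (\<forall>u v. h u = h v \<longleftrightarrow> (u, v) \<in> bicyclic_relation))"
  (is "_ \<longleftrightarrow> _ \<and> (\<exists>h. ?presents h)")
proof -
  note cong = bicyclic_relation_congruence
  let ?class = "\<lambda>w. bicyclic_relation `` {w}"
  have bic: "bicyclic = quotient_monoid free_monoid bicyclic_relation"
    by (simp add: bicyclic_def bicyclic_relation_def)
  have bic_carrier: "carrier bicyclic = range ?class"
    by (auto simp: bic quotient_monoid_simps quotient_def)
  have bic_mult: "?class u \<otimes>\<^bsub>bicyclic\<^esub> ?class v = ?class (u @ v)" for u v
    using quotient_monoid_mult[OF cong, of u v] by (simp add: bic)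
  have class_eq: "?class u = ?class v \<longleftrightarrow> (u, v) \<in> bicyclic_relation" for u v
    using eq_equiv_class_iff[OF congruence_on_equiv[OF cong], of u v] by simp
  have pres: "\<exists>h. ?presents h" if S: "bicyclic_subsemigroup S G"
  proof -
    obtain f where f: "f \<in> hom (G\<lparr>carrier := S\<rparr>) bicyclic" "bij_betw f S (range ?class)"
      using S unfolding bicyclic_subsemigroup_def is_iso_def iso_def
      by (auto simp: bic_carrier)
    have closed: "a \<otimes>\<^bsub>G\<^esub> b \<in> S" if "a \<in> S" "b \<in> S" for a b
      using S that by (auto simp: bicyclic_subsemigroup_def subsemigroup_def)
    have f_mult: "f (a \<otimes>\<^bsub>G\<^esub> b) = f a \<otimes>\<^bsub>bicyclic\<^esub> f b" if "a \<in> S" "b \<in> S" for a b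
      using f(1) that by (auto simp: hom_def)
    have f_inj: "a = b" if "f a = f b" "a \<in> S" "b \<in> S" for a b
      using f(2) that by (auto simp: bij_betw_def inj_on_def)
    define h where "h = (\<lambda>w. inv_into S f (?class w))"
    have hS: "h w \<in> S" and fh: "f (h w) = ?class w" for w
      using f(2) unfolding h_def bij_betw_def
      by (metis inv_into_into rangeI, metis f_inv_into_f rangeI)
    have "S \<subseteq> range h"
    proof
      fix a assume a: "a \<in> S"
      then obtain w where "f a = ?class w" using f(2) unfolding bij_betw_def by blast
      then have "a = h w" using f_inj a hS fh by metis
      then show "a \<in> range h" by blast
    qed
    moreover have "h (u @ v) = h u \<otimes>\<^bsub>G\<^esub> h v" for u v
      by (rule f_inj) (simp_all add: hS closed f_mult fh bic_mult)
    moreover have "h u = h v \<longleftrightarrow> (u, v) \<in> bicyclic_relation" for u v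
      using fh f_inj hS class_eq by metis
    ultimately show ?thesis using hS by (intro exI[of _ h]) auto
  qed
  have bicyc: "bicyclic_subsemigroup S G" if sub: "S \<subseteq> carrier G" and "?presents h" for h
  proof -
    have h: "range h = S" "\<And>u v. h (u @ v) = h u \<otimes>\<^bsub>G\<^esub> h v"
      "\<And>u v. h u = h v \<longleftrightarrow> (u, v) \<in> bicyclic_relation"
      using that by blast+
    define f where "f = (\<lambda>a. {w. h w = a})"
    have fh: "f (h w) = ?class w" for w unfolding f_def by (auto simp flip: h(3))
    have mult: "h u \<otimes>\<^bsub>G\<^esub> h v \<in> S" for u v using h by (metis rangeI)
    have "f ` S = range ?class" by (simp add: image_image fh flip: h(1))
    moreover have "f \<in> hom (G\<lparr>carrier := S\<rparr>) bicyclic"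
    proof (rule homI)
      show "f a \<in> carrier bicyclic" if "a \<in> carrier (G\<lparr>carrier := S\<rparr>)" for a
        using that \<open>f ` S = range ?class\<close> by (auto simp: bic_carrier)
      fix a b assume "a \<in> carrier (G\<lparr>carrier := S\<rparr>)" "b \<in> carrier (G\<lparr>carrier := S\<rparr>)"
      then obtain u v where "a = h u" "b = h v" by (auto simp flip: h(1))
      then show "f (a \<otimes>\<^bsub>G\<lparr>carrier := S\<rparr>\<^esub> b) = f a \<otimes>\<^bsub>bicyclic\<^esub> f b"
        by (simp add: fh bic_mult flip: h(2))
    qed
    moreover have "inj_on f S"
      using h(3) by (auto simp: inj_on_def fh class_eq simp flip: h(1))
    moreover have "subsemigroup S G"
      unfolding subsemigroup_def using sub mult h(1) by auto
    ultimately show ?thesis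
      unfolding bicyclic_subsemigroup_def is_iso_def iso_def bij_betw_def
      by (auto simp: bic_carrier)
  qed
  show ?thesis
  proof (rule iffI)
    assume S: "bicyclic_subsemigroup S G"
    then have "S \<subseteq> carrier G" by (simp add: bicyclic_subsemigroup_def subsemigroup_def)
    then show "S \<subseteq> carrier G \<and> (\<exists>h. ?presents h)" using pres[OF S] by (rule conjI)
  next
    assume "S \<subseteq> carrier G \<and> (\<exists>h. ?presents h)"
    then show "bicyclic_subsemigroup S G" by (elim conjE[of "_ \<subseteq> _"] exE) (rule bicyc)
  qed
qed

section \<open>Cofinite isometries are partial translations\<close>

text \<open>Domains are sets of integers, so that translating them back and forth never truncates.\<close>

definition ptrans :: "int \<Rightarrow> int set \<Rightarrow> nat \<rightharpoonup> nat" where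
  "ptrans k D = (\<lambda>n. if int n \<in> D then Some (nat (int n + k)) else None)"

definition shiftable :: "int \<Rightarrow> int set \<Rightarrow> bool" where
  "shiftable k D \<longleftrightarrow> D \<subseteq> {1..} \<and> (\<exists>m. {m..} \<subseteq> D) \<and> (\<forall>x\<in>D. 1 \<le> x + k)"

lemma shiftable_atLeast: "1 \<le> m \<Longrightarrow> 1 \<le> m + k \<Longrightarrow> shiftable k {m..}"
  unfolding shiftable_def by (auto intro!: exI[of _ m])

lemma shiftable_cofinal:
  assumes "shiftable k D" obtains m where "r \<le> m" "{m..} \<subseteq> D"
proof -
  obtain m where "{m..} \<subseteq> D" using assms by (auto simp: shiftable_def)
  then have "{max r m..} \<subseteq> D" by auto
  then show ?thesis using that[of "max r m"] by simp
qed

lemma ptrans_carrier: 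
  assumes "shiftable k D" shows "ptrans k D \<in> carrier IN_inf"
proof -
  obtain m where m: "{m..} \<subseteq> D" using assms by (auto simp: shiftable_def)
  have D: "D \<subseteq> {1..}" "\<And>x. x \<in> D \<Longrightarrow> 1 \<le> x + k" using assms by (auto simp: shiftable_def)
  have dom: "dom (ptrans k D) = {n. int n \<in> D}" by (auto simp: ptrans_def split: if_splits)
  have "n \<in> ran (ptrans k D)" if "nat (m + k) < n" "1 \<le> n" for n
  proof -
    have "int n - k \<in> D" using m that by auto
    moreover then have "1 \<le> int n - k" using D(1) by auto
    ultimately have "ptrans k D (nat (int n - k)) = Some n" by (simp add: ptrans_def)
    then show ?thesis by (rule ranI)
  qed
  then have "{1..} - ran (ptrans k D) \<subseteq> {..nat (m + k)}"
    by (metis (no_types, lifting) DiffE atLeast_iff atMost_iff not_le subsetI)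
  moreover have "{1..} - dom (ptrans k D) \<subseteq> {..nat m}" using m unfolding dom by force
  moreover have "dom (ptrans k D) \<subseteq> {1..}" using D(1) unfolding dom by auto
  moreover have "ran (ptrans k D) \<subseteq> {1..}"
    using D(2) by (fastforce simp: ptrans_def ran_def split: if_splits)
  moreover have "\<bar>int (the (ptrans k D x)) - int (the (ptrans k D y))\<bar> = \<bar>int x - int y\<bar>"
    if "x \<in> dom (ptrans k D)" "y \<in> dom (ptrans k D)" for x y
    using that D(2)[of "int x"] D(2)[of "int y"] unfolding dom by (simp add: ptrans_def)
  ultimately show ?thesis
    unfolding IN_inf_def partial_cofinite_isometry_def
    by (auto intro: finite_subset)
qed

text \<open>For \<open>y\<close> far to the right of \<open>x\<close>, the value of \<open>\<alpha>\<close> at \<open>y\<close> cannot lie to the left of that at \<open>x\<close>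
  by \<open>y - x\<close>, for it would be negative. So \<open>x\<close> and \<open>y\<close> are moved by the same amount; any two
  points can be compared with a common \<open>y\<close>.\<close>

lemma carrier_ptransE:
  assumes "\<alpha> \<in> carrier IN_inf"
  obtains k D where "shiftable k D" "\<alpha> = ptrans k D"
proof -
  have \<alpha>: "dom \<alpha> \<subseteq> {1..}" "ran \<alpha> \<subseteq> {1..}" "finite ({1..} - dom \<alpha>)"
    and iso: "\<And>x y. x \<in> dom \<alpha> \<Longrightarrow> y \<in> dom \<alpha> \<Longrightarrow>
        \<bar>int (the (\<alpha> x)) - int (the (\<alpha> y))\<bar> = \<bar>int x - int y\<bar>"
    using assms by (auto simp: IN_inf_def partial_cofinite_isometry_def)
  obtain N where "\<forall>n\<in>{1..} - dom \<alpha>. n \<le> N"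
    using \<alpha>(3) by (auto simp: finite_nat_set_iff_bounded_le)
  then have N: "n \<in> dom \<alpha>" if "N < n" for n
    using that by (metis DiffI One_nat_def Suc_leI atLeast_iff not_le not_less_zero not_gr_zero)
  define f where "f = (\<lambda>n. int (the (\<alpha> n)))"
  have const: "f y - int y = f x - int x"
    if "x \<in> dom \<alpha>" "y \<in> dom \<alpha>" "int x + f x < int y" for x y
    using iso[OF that(1,2)] that(3) unfolding f_def by linarith
  define k where "k = f (Suc N) - int (Suc N)"
  have k: "f x = int x + k" if "x \<in> dom \<alpha>" for x
  proof -
    define y where "y = Suc (Suc x + N + nat (f x) + nat (f (Suc N)))"
    have "y \<in> dom \<alpha>" "int x + f x < int y" "int (Suc N) + f (Suc N) < int y"
      using N by (auto simp: y_def)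
    then show ?thesis
      using const[OF that] const[of "Suc N" y] N unfolding k_def by auto
  qed
  have "\<alpha> n = ptrans k (int ` dom \<alpha>) n" for n
  proof (cases "n \<in> dom \<alpha>")
    case True
    then have "int (the (\<alpha> n)) = int n + k" using k by (simp add: f_def)
    then show ?thesis using True by (auto simp: ptrans_def)
  next
    case False
    then show ?thesis by (auto simp: ptrans_def domIff image_iff)
  qed
  moreover have "shiftable k (int ` dom \<alpha>)"
  proof -
    have "{int (Suc N)..} \<subseteq> int ` dom \<alpha>"
    proof
      fix z assume "z \<in> {int (Suc N)..}"
      then have "z = int (nat z)" "nat z \<in> dom \<alpha>" using N by auto
      then show "z \<in> int ` dom \<alpha>" by blast
    qed
    moreover have "1 \<le> int x + k" if "x \<in> dom \<alpha>" for x
    proof -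
      have "the (\<alpha> x) \<in> ran \<alpha>" using that by (auto intro: ranI)
      then have "1 \<le> f x" using \<alpha>(2) by (auto simp: f_def)
      then show ?thesis using k[OF that] by simp
    qed
    ultimately show ?thesis using \<alpha>(1) unfolding shiftable_def by fastforce
  qed
  ultimately show ?thesis using that by blast
qed

lemma ptrans_mult:
  assumes "shiftable k D"
  shows "ptrans k D \<otimes>\<^bsub>IN_inf\<^esub> ptrans l E = ptrans (k + l) {x \<in> D. x + k \<in> E}"
proof
  fix n
  show "(ptrans k D \<otimes>\<^bsub>IN_inf\<^esub> ptrans l E) n = ptrans (k + l) {x \<in> D. x + k \<in> E} n"
    using assms unfolding shiftable_def
    by (cases "int n \<in> D") (auto simp: IN_inf_def map_comp_def ptrans_def algebra_simps)
qed

lemma shiftable_mult: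
  assumes "shiftable k D" "shiftable l E"
  shows "shiftable (k + l) {x \<in> D. x + k \<in> E}"
proof -
  obtain m n where "{m..} \<subseteq> D" "{n..} \<subseteq> E" using assms by (auto simp: shiftable_def)
  then have "{max m (n - k)..} \<subseteq> {x \<in> D. x + k \<in> E}" by (simp add: subset_iff)
  moreover have "1 \<le> x + (k + l)" if "x + k \<in> E" for x
  proof -
    have "1 \<le> (x + k) + l" using assms(2) that unfolding shiftable_def by blast
    then show ?thesis by (simp add: add.assoc)
  qed
  ultimately show ?thesis using assms(1) unfolding shiftable_def by blast
qed

lemma ptrans_inject:
  assumes "shiftable k D" "shiftable l E"
  shows "ptrans k D = ptrans l E \<longleftrightarrow> k = l \<and> D = E"
proof
  assume eq: "ptrans k D = ptrans l E"
  have sub: "D' \<subseteq> E'" if "shiftable k' D'" "ptrans k' D' = ptrans l' E'" for k' l' D' E'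
  proof
    fix x assume "x \<in> D'"
    moreover then have "x = int (nat x)" using that(1) by (auto simp: shiftable_def)
    ultimately show "x \<in> E'" using fun_cong[OF that(2), of "nat x"]
      by (auto simp: ptrans_def split: if_splits)
  qed
  have "D = E" using sub[OF assms(1) eq] sub[OF assms(2) eq[symmetric]] by blast
  obtain m where "1 \<le> m" "{m..} \<subseteq> D" using shiftable_cofinal[OF assms(1)] by blast
  then have "m \<in> D" "m \<in> E" "m = int (nat m)" using \<open>D = E\<close> by auto
  moreover from this have "1 \<le> m + k" "1 \<le> m + l" using assms by (auto simp: shiftable_def)
  ultimately show "k = l \<and> D = E"
    using fun_cong[OF eq, of "nat m"] \<open>D = E\<close> by (simp add: ptrans_def)
qed simp

lemma one_ptrans: "\<one>\<^bsub>IN_inf\<^esub> = ptrans 0 {1..}"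
  by (auto simp: IN_inf_def ptrans_def restrict_map_def)

lemma monoid_IN_inf: "monoid IN_inf"
proof
  show "a \<otimes>\<^bsub>IN_inf\<^esub> b \<in> carrier IN_inf"
    if "a \<in> carrier IN_inf" "b \<in> carrier IN_inf" for a b
    using that by (elim carrier_ptransE) (simp add: ptrans_mult ptrans_carrier shiftable_mult)
  show "(a \<otimes>\<^bsub>IN_inf\<^esub> b) \<otimes>\<^bsub>IN_inf\<^esub> c = a \<otimes>\<^bsub>IN_inf\<^esub> (b \<otimes>\<^bsub>IN_inf\<^esub> c)" for a b c
    by (auto simp: IN_inf_def map_comp_def split: option.splits)
  show "\<one>\<^bsub>IN_inf\<^esub> \<in> carrier IN_inf"
    unfolding one_ptrans by (intro ptrans_carrier shiftable_atLeast) auto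
  show "\<one>\<^bsub>IN_inf\<^esub> \<otimes>\<^bsub>IN_inf\<^esub> a = a" if a: "a \<in> carrier IN_inf" for a
  proof -
    obtain k D where "shiftable k D" "a = ptrans k D" using a by (rule carrier_ptransE)
    moreover then have "{x \<in> {1..}. x + 0 \<in> D} = D" by (auto simp: shiftable_def)
    ultimately show ?thesis by (simp add: one_ptrans ptrans_mult shiftable_atLeast)
  qed
  show "a \<otimes>\<^bsub>IN_inf\<^esub> \<one>\<^bsub>IN_inf\<^esub> = a" if a: "a \<in> carrier IN_inf" for a
  proof -
    obtain k D where "shiftable k D" "a = ptrans k D" using a by (rule carrier_ptransE)
    moreover then have "{x \<in> D. x + k \<in> {1..}} = D" by (auto simp: shiftable_def)
    ultimately show ?thesis by (simp add: one_ptrans ptrans_mult)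
  qed
qed

section \<open>Congruences that identify all idempotents\<close>

text \<open>The inverse translation is a left inverse up to an idempotent.\<close>

lemma group_congruence_if_idempotents:
  assumes C: "congruence_on IN_inf C"
    and idem: "\<And>E. shiftable 0 E \<Longrightarrow> (ptrans 0 E, \<one>\<^bsub>IN_inf\<^esub>) \<in> C"
  shows "group_congruence IN_inf C"
proof (subst quotient_group_iff[OF monoid_IN_inf C], intro ballI)
  fix a assume "a \<in> carrier IN_inf"
  then obtain k D where a: "shiftable k D" "a = ptrans k D" by (rule carrier_ptransE)
  let ?R = "{x. x - k \<in> D}"
  obtain m where "{m..} \<subseteq> D" using a by (auto simp: shiftable_def)
  then have "{m + k..} \<subseteq> ?R" by auto
  then have R: "shiftable (- k) ?R" "shiftable 0 ?R"
    using a(1) by (fastforce simp: shiftable_def)+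
  have "ptrans (- k) ?R \<otimes>\<^bsub>IN_inf\<^esub> a = ptrans 0 ?R"
    by (simp add: a(2) ptrans_mult[OF R(1)])
  then show "\<exists>b\<in>carrier IN_inf. (b \<otimes>\<^bsub>IN_inf\<^esub> a, \<one>\<^bsub>IN_inf\<^esub>) \<in> C"
    using idem[OF R(2)] ptrans_carrier[OF R(1)] by metis
qed

text \<open>Moving \<open>x\<close> to \<open>1\<close> turns \<open>D\<close> into the whole half-line and \<open>E\<close> into a set missing \<open>1\<close>. This is the
  mechanism by which one equivalence between idempotents spreads to all: the first gap propagates
  along the half-line by translation.\<close>

lemma group_congruence_if_gap:
  assumes C: "congruence_on IN_inf C" and DE: "(ptrans 0 D, ptrans 0 E) \<in> C"
    and sh: "shiftable 0 D" "shiftable 0 E"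
    and x: "1 \<le> x" "{x..} \<subseteq> D" "x \<notin> E"
  shows "group_congruence IN_inf C"
proof (rule group_congruence_if_idempotents[OF C])
  let ?id = "\<lambda>n. ptrans 0 {n..}"
  define G where "G = {y. 1 \<le> y \<and> y + (x - 1) \<in> E}"
  have up: "shiftable r {1..}" if "0 \<le> r" for r using that by (intro shiftable_atLeast) auto
  have down: "shiftable (1 - x) {x..}" using x by (intro shiftable_atLeast) auto
  obtain m where m: "x \<le> m" "{m..} \<subseteq> E" using shiftable_cofinal[OF sh(2)] by blast
  then have "{m..} \<subseteq> G" using x unfolding G_def by auto
  moreover have "\<forall>y\<in>G. 1 \<le> y" by (simp add: G_def)
  ultimately have G: "shiftable 0 G" unfolding shiftable_def by auto
  have "((ptrans (x - 1) {1..} \<otimes>\<^bsub>IN_inf\<^esub> ptrans 0 D) \<otimes>\<^bsub>IN_inf\<^esub> ptrans (1 - x) {x..},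
         (ptrans (x - 1) {1..} \<otimes>\<^bsub>IN_inf\<^esub> ptrans 0 E) \<otimes>\<^bsub>IN_inf\<^esub> ptrans (1 - x) {x..}) \<in> C"
    using x by (intro congruence_on_sandwich[OF C DE] ptrans_carrier up down) auto
  moreover have
    "(ptrans (x - 1) {1..} \<otimes>\<^bsub>IN_inf\<^esub> ptrans 0 F) \<otimes>\<^bsub>IN_inf\<^esub> ptrans (1 - x) {x..}
      = ptrans 0 {y. 1 \<le> y \<and> y + (x - 1) \<in> F}" if "shiftable 0 F" for F
  proof -
    have "{y \<in> {y \<in> {1..}. y + (x - 1) \<in> F}. y + (x - 1 + 0) \<in> {x..}}
        = {y. 1 \<le> y \<and> y + (x - 1) \<in> F}" by auto
    then show ?thesis
      using ptrans_mult[OF up[of "x - 1"], of 0 F] x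
        ptrans_mult[OF shiftable_mult[OF up[of "x - 1"] that], of "1 - x" "{x..}"] by simp
  qed
  moreover have "{y. 1 \<le> y \<and> y + (x - 1) \<in> D} = {1..}" using x(2) by auto
  ultimately have 1: "(?id 1, ptrans 0 G) \<in> C" using sh by (simp add: G_def)
  have mult_id: "ptrans 0 F \<otimes>\<^bsub>IN_inf\<^esub> ?id n = ptrans 0 (F \<inter> {n..})" if "shiftable 0 F" for F n
    using ptrans_mult[OF that, of 0 "{n..}"] by (simp add: Int_def)
  (* Multiplying by the identity of {2..} fixes G, which misses 1, but not {1..}. *)
  have "?id 2 \<in> carrier IN_inf" by (intro ptrans_carrier shiftable_atLeast) auto
  then have "(?id 1 \<otimes>\<^bsub>IN_inf\<^esub> ?id 2, ptrans 0 G \<otimes>\<^bsub>IN_inf\<^esub> ?id 2) \<in> C"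
    by (intro congruence_on_mult[OF C 1] congruence_on_refl[OF C])
  moreover have "G \<inter> {2..} = G"
  proof -
    have "1 \<notin> G" using x(3) by (simp add: G_def)
    then have "y \<noteq> 1" if "y \<in> G" for y using that by auto
    then show ?thesis unfolding G_def by force
  qed
  moreover have "{1..} \<inter> {2..} = {2::int..}" by auto
  ultimately have "(?id 2, ptrans 0 G) \<in> C" using up[of 0] G by (simp add: mult_id)
  then have 2: "(?id 2, ?id 1) \<in> C"
    using congruence_on_sym[OF C 1] by (rule congruence_on_trans[OF C])
  have tail: "(?id (int n + 1), ?id 1) \<in> C" for n
  proof (induction n)
    case 0
    show ?case using congruence_on_refl[OF C ptrans_carrier[OF up[of 0]]] by simp
  next
    case (Suc n)
    have s: "shiftable (- 1) {2..}" by (intro shiftable_atLeast) auto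
    have "((ptrans (- 1) {2..} \<otimes>\<^bsub>IN_inf\<^esub> ?id (int n + 1)) \<otimes>\<^bsub>IN_inf\<^esub> ptrans 1 {1..},
           (ptrans (- 1) {2..} \<otimes>\<^bsub>IN_inf\<^esub> ?id 1) \<otimes>\<^bsub>IN_inf\<^esub> ptrans 1 {1..}) \<in> C"
      by (intro congruence_on_sandwich[OF C Suc] ptrans_carrier up s) auto
    moreover have
      "(ptrans (- 1) {2..} \<otimes>\<^bsub>IN_inf\<^esub> ?id j) \<otimes>\<^bsub>IN_inf\<^esub> ptrans 1 {1..} = ?id (j + 1)"
      if j: "1 \<le> j" for j
    proof -
      have j': "shiftable 0 {j..}" using j by (intro shiftable_atLeast) auto
      have "{y \<in> {y \<in> {2..}. y + - 1 \<in> {j..}}. y + (- 1 + 0) \<in> {1..}} = {j + 1..}"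
        using j by auto
      then show ?thesis
        using ptrans_mult[OF s, of 0 "{j..}"]
          ptrans_mult[OF shiftable_mult[OF s j'], of 1 "{1..}"] by simp
    qed
    ultimately have "(?id (int n + 1 + 1), ?id (1 + 1)) \<in> C" by simp
    then show ?case using congruence_on_trans[OF C _ 2] by (simp add: add.commute)
  qed
  fix F assume F: "shiftable 0 F"
  obtain n where n: "1 \<le> n" "{n..} \<subseteq> F" using shiftable_cofinal[OF F] by blast
  have "(ptrans 0 F \<otimes>\<^bsub>IN_inf\<^esub> ?id n, ptrans 0 F \<otimes>\<^bsub>IN_inf\<^esub> ?id 1) \<in> C"
    using tail[of "nat (n - 1)"] n
    by (intro congruence_on_mult[OF C congruence_on_refl[OF C ptrans_carrier[OF F]]]) simp
  moreover have "F \<inter> {n..} = {n..}" "F \<inter> {1..} = F"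
    using n F by (auto simp: shiftable_def)
  ultimately have "(ptrans 0 F, ?id n) \<in> C"
    using F by (simp add: mult_id congruence_on_sym[OF C])
  moreover have "(?id n, ?id 1) \<in> C" using tail[of "nat (n - 1)"] n by simp
  ultimately show "(ptrans 0 F, \<one>\<^bsub>IN_inf\<^esub>) \<in> C"
    unfolding one_ptrans by (rule congruence_on_trans[OF C])
qed

text \<open>After cancelling translations, \<open>x \<mapsto> x - d\<close> on \<open>{d + 1..}\<close> is equivalent to the identity for some
  \<open>d > 0\<close>. Its inverse, translation by \<open>d\<close>, is then also equivalent to the identity, and hence
  so is their product in the other order, the identity of \<open>{d + 1..}\<close>, which misses \<open>1\<close>.\<close>

lemma group_congruence_if_distinct_shift:
  assumes C: "congruence_on IN_inf C" and DE: "(ptrans k D, ptrans l E) \<in> C"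
    and sh: "shiftable k D" "shiftable l E" and "k \<noteq> l"
  shows "group_congruence IN_inf C"
proof -
  have main: "group_congruence IN_inf C"
    if DE: "(ptrans k D, ptrans l E) \<in> C" and sh: "shiftable k D" "shiftable l E"
      and "k < l" for k l D E
  proof -
    obtain m n where m: "1 \<le> m" "{m..} \<subseteq> D" and n: "1 \<le> n" "{n..} \<subseteq> E"
      using shiftable_cofinal[OF sh(1)] shiftable_cofinal[OF sh(2)] by metis
    (* Restricting to points beyond r hides the gaps of D and E, leaving only the amounts. *)
    define r where "r = max m n - 1"
    have r: "0 \<le> r" "{r + 1..} \<subseteq> D" "{r + 1..} \<subseteq> E" using m n by (auto simp: r_def)
    have "r + 1 \<in> D" "r + 1 \<in> E" using r by auto
    then have kl: "0 \<le> r + k" "0 \<le> r + l" using sh by (auto simp: shiftable_def)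
    have u: "shiftable r {1..}" using r by (intro shiftable_atLeast) auto
    have v: "shiftable (- (r + l)) {r + l + 1..}" using kl by (intro shiftable_atLeast) auto
    let ?uv = "\<lambda>a. (ptrans r {1..} \<otimes>\<^bsub>IN_inf\<^esub> a) \<otimes>\<^bsub>IN_inf\<^esub> ptrans (- (r + l)) {r + l + 1..}"
    have "(?uv (ptrans k D), ?uv (ptrans l E)) \<in> C"
      by (intro congruence_on_sandwich[OF C DE] ptrans_carrier u v)
    moreover have "?uv (ptrans j F) = ptrans (j - l) {max 1 (l - j + 1)..}"
      if F: "shiftable j F" "{r + 1..} \<subseteq> F" for j F
    proof -
      have "{x \<in> {x \<in> {1..}. x + r \<in> F}. x + (r + j) \<in> {r + l + 1..}} = {max 1 (l - j + 1)..}"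
        using F(2) by auto
      then show ?thesis
        using ptrans_mult[OF u, of j F]
          ptrans_mult[OF shiftable_mult[OF u F(1)], of "- (r + l)" "{r + l + 1..}"] by simp
    qed
    ultimately have "(ptrans (k - l) {max 1 (l - k + 1)..}, ptrans 0 {1..}) \<in> C"
      using sh r by auto
    moreover define d where "d = l - k"
    ultimately have s1: "(ptrans (- d) {d + 1..}, ptrans 0 {1..}) \<in> C" and d: "0 < d"
      using \<open>k < l\<close> by (auto simp: max_def)
    have s: "shiftable (- d) {d + 1..}" and t: "shiftable d {1..}"
      using d by (auto intro!: shiftable_atLeast)
    have "(ptrans d {1..} \<otimes>\<^bsub>IN_inf\<^esub> ptrans (- d) {d + 1..},
           ptrans d {1..} \<otimes>\<^bsub>IN_inf\<^esub> ptrans 0 {1..}) \<in> C"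
      by (intro congruence_on_mult[OF C] congruence_on_refl[OF C] ptrans_carrier t s1)
    moreover have "{x \<in> {1..}. x + d \<in> {d + 1..}} = {1..}" "{x \<in> {1..}. x + d \<in> {1..}} = {1..}"
      using d by auto
    ultimately have t1: "(ptrans 0 {1..}, ptrans d {1..}) \<in> C"
      using ptrans_mult[OF t] by simp
    have "(ptrans 0 {1..} \<otimes>\<^bsub>IN_inf\<^esub> ptrans 0 {1..},
           ptrans (- d) {d + 1..} \<otimes>\<^bsub>IN_inf\<^esub> ptrans d {1..}) \<in> C"
      by (rule congruence_on_mult[OF C congruence_on_sym[OF C s1] t1])
    moreover have "{x \<in> {d + 1..}. x - d \<in> {1..}} = {d + 1..}" by auto
    moreover have z: "shiftable 0 {1..}" by (intro shiftable_atLeast) auto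
    ultimately have "(ptrans 0 {1..}, ptrans 0 {d + 1..}) \<in> C"
      using ptrans_mult[OF s, of d "{1..}"] ptrans_mult[OF z, of 0 "{1..}"] by (simp add: atLeast_def)
    moreover have "shiftable 0 {d + 1..}" using d by (intro shiftable_atLeast) auto
    ultimately show ?thesis
      using z d by (intro group_congruence_if_gap[OF C, of "{1..}" "{d + 1..}" 1]) auto
  qed
  show ?thesis
  proof (cases "k < l")
    case True
    then show ?thesis using main[OF DE sh] by blast
  next
    case False
    then show ?thesis using main[OF congruence_on_sym[OF C DE] sh(2,1)] assms(5) by simp
  qed
qed

section \<open>Bicyclic subsemigroups of cofinite isometries\<close>

text \<open>The copy of the bicyclic semigroup in which \<open>p\<close> is the unilateral shift \<open>x \<mapsto> x + 1\<close>.\<close>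

definition bicyclic_eval :: "bicyclic_generator list \<Rightarrow> nat \<rightharpoonup> nat" where
  "bicyclic_eval w = foldr (\<lambda>g a. (case g of Gen_p \<Rightarrow> ptrans 1 {1..} | Gen_q \<Rightarrow> ptrans (- 1) {2..})
     \<otimes>\<^bsub>IN_inf\<^esub> a) w \<one>\<^bsub>IN_inf\<^esub>"

lemma shiftable_pq: "shiftable 1 {1..}" "shiftable (- 1) {2..}"
  by (simp_all add: shiftable_atLeast)

lemma bicyclic_eval_simps [simp]:
  "bicyclic_eval [] = \<one>\<^bsub>IN_inf\<^esub>"
  "bicyclic_eval (Gen_p # w) = ptrans 1 {1..} \<otimes>\<^bsub>IN_inf\<^esub> bicyclic_eval w"
  "bicyclic_eval (Gen_q # w) = ptrans (- 1) {2..} \<otimes>\<^bsub>IN_inf\<^esub> bicyclic_eval w"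
  by (simp_all add: bicyclic_eval_def)

lemma bicyclic_eval_carrier: "bicyclic_eval w \<in> carrier IN_inf"
proof -
  interpret monoid IN_inf by (rule monoid_IN_inf)
  have "bicyclic_eval (g # w) \<in> carrier IN_inf" if "bicyclic_eval w \<in> carrier IN_inf" for g w
    using that by (cases g) (simp_all add: ptrans_carrier shiftable_pq)
  then show ?thesis by (induction w) auto
qed

lemma bicyclic_eval_append:
  "bicyclic_eval (u @ v) = bicyclic_eval u \<otimes>\<^bsub>IN_inf\<^esub> bicyclic_eval v"
proof -
  interpret monoid IN_inf by (rule monoid_IN_inf)
  show ?thesis
  proof (induction u)
    case (Cons g u)
    then show ?case
      by (cases g) (simp_all add: m_assoc ptrans_carrier shiftable_pq bicyclic_eval_carrier)
  qed (simp add: bicyclic_eval_carrier)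
qed

lemma bicyclic_eval_normal_form:
  "bicyclic_eval (replicate i Gen_q @ replicate j Gen_p) = ptrans (int j - int i) {int i + 1..}"
proof (induction i)
  case 0
  show ?case
  proof (induction j)
    case (Suc j)
    have "{x \<in> {1..}. x + 1 \<in> {1..}} = {1::int..}" by auto
    then show ?case
      using Suc ptrans_mult[OF shiftable_pq(1), of "int j" "{1..}"] by (simp add: add.commute)
  qed (simp add: one_ptrans)
next
  case (Suc i)
  have "{x \<in> {2..}. x + - 1 \<in> {int i + 1..}} = {int (Suc i) + 1..}" by auto
  then show ?case
    using Suc ptrans_mult[OF shiftable_pq(2), of "int j - int i" "{int i + 1..}"]
    by (simp add: algebra_simps)
qed

text \<open>Distinct normal forms have distinct values: the domain determines \<open>i\<close>, the amount of translation
  then \<open>j\<close>. So no relation beyond the defining one holds.\<close>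

lemma bicyclic_eval_eq_iff:
  "bicyclic_eval u = bicyclic_eval v \<longleftrightarrow> (u, v) \<in> bicyclic_relation"
proof
  have "bicyclic_eval [Gen_p, Gen_q] = bicyclic_eval []"
  proof -
    have "{x \<in> {1..}. x + 1 \<in> {2..}} = {1::int..}" by auto
    then have "ptrans 1 {1..} \<otimes>\<^bsub>IN_inf\<^esub> ptrans (- 1) {2..} = \<one>\<^bsub>IN_inf\<^esub>"
      using ptrans_mult[OF shiftable_pq(1), of "- 1" "{2..}"] by (simp add: one_ptrans)
    moreover have "ptrans (- 1) {2..} \<otimes>\<^bsub>IN_inf\<^esub> \<one>\<^bsub>IN_inf\<^esub> = ptrans (- 1) {2..}"
      using monoid.r_one[OF monoid_IN_inf ptrans_carrier[OF shiftable_pq(2)]] .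
    ultimately show ?thesis by simp
  qed
  then have resp: "bicyclic_eval u = bicyclic_eval v" if "(u, v) \<in> bicyclic_relation" for u v
    using bicyclic_relation_least[where G = IN_inf, OF bicyclic_eval_append _ that] by blast
  then show "(u, v) \<in> bicyclic_relation \<Longrightarrow> bicyclic_eval u = bicyclic_eval v" .
  assume eq: "bicyclic_eval u = bicyclic_eval v"
  obtain i j where u: "(u, replicate i Gen_q @ replicate j Gen_p) \<in> bicyclic_relation"
    using bicyclic_normal_form by blast
  obtain i' j' where v: "(v, replicate i' Gen_q @ replicate j' Gen_p) \<in> bicyclic_relation"
    using bicyclic_normal_form by blast
  have "ptrans (int j - int i) {int i + 1..} = ptrans (int j' - int i') {int i' + 1..}"
    using eq resp[OF u] resp[OF v] by (simp only: bicyclic_eval_normal_form)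
  moreover have "shiftable (int m - int n) {int n + 1..}" for m n
    by (intro shiftable_atLeast) auto
  ultimately have "int j - int i = int j' - int i' \<and> {int i + 1..} = {int i' + 1..}"
    by (simp only: ptrans_inject)
  then have "i = i'" "j = j'" by auto
  then have "(u, replicate i' Gen_q @ replicate j' Gen_p) \<in> bicyclic_relation" using u by simp
  then show "(u, v) \<in> bicyclic_relation"
    using congruence_on_sym[OF bicyclic_relation_congruence v]
    by (rule congruence_on_trans[OF bicyclic_relation_congruence])
qed

lemma bicyclic_subsemigroup_exists: "bicyclic_subsemigroup (range bicyclic_eval) IN_inf"
  unfolding bicyclic_subsemigroup_iff
  using bicyclic_eval_carrier bicyclic_eval_append bicyclic_eval_eq_iff by blast

text \<open>The shift model separates \<open>qp\<close> from \<open>1\<close>; this transfers to every bicyclic subsemigroup.\<close>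

lemma bicyclic_relation_qp: "([Gen_q, Gen_p], []) \<notin> bicyclic_relation"
proof
  assume "([Gen_q, Gen_p], []) \<in> bicyclic_relation"
  then have "bicyclic_eval (replicate 1 Gen_q @ replicate 1 Gen_p)
      = bicyclic_eval (replicate 0 Gen_q @ replicate 0 Gen_p)"
    using bicyclic_eval_eq_iff[of "[Gen_q, Gen_p]" "[]"] by simp
  then have "ptrans 0 {2..} = ptrans 0 {1..}"
    unfolding bicyclic_eval_normal_form by simp
  moreover have "shiftable 0 {2..}" "shiftable 0 {1..}" by (simp_all add: shiftable_atLeast)
  ultimately show False using ptrans_inject by fastforce
qed

lemma bicyclic_subsemigroup_generators:
  assumes "bicyclic_subsemigroup S G"
  obtains h where "range h = S" "\<forall>u v. h (u @ v) = h u \<otimes>\<^bsub>G\<^esub> h v"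
    "h [Gen_p, Gen_q] = h []" "h [Gen_q, Gen_p] \<noteq> h []"
  using assms bicyclic_relation_pq bicyclic_relation_qp unfolding bicyclic_subsemigroup_iff
  by metis

lemma bicyclic_subsemigroup_idempotents:
  assumes "bicyclic_subsemigroup S G"
  obtains e f where "e \<in> S" "f \<in> S" "e \<noteq> f" "e \<otimes>\<^bsub>G\<^esub> e = e" "f \<otimes>\<^bsub>G\<^esub> f = f"
proof -
  obtain h where h: "range h = S" "\<forall>u v. h (u @ v) = h u \<otimes>\<^bsub>G\<^esub> h v"
    "h [Gen_p, Gen_q] = h []" "h [Gen_q, Gen_p] \<noteq> h []"
    using assms by (rule bicyclic_subsemigroup_generators)
  have h2: "h (u @ v) = h u \<otimes>\<^bsub>G\<^esub> h v" for u v using h(2) by blast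
  have "h [] \<otimes>\<^bsub>G\<^esub> h [] = h []" using h2[of "[]" "[]"] by simp
  moreover have "h [Gen_q, Gen_p] \<otimes>\<^bsub>G\<^esub> h [Gen_q, Gen_p] = h [Gen_q, Gen_p]"
  proof -
    have "h ([Gen_q] @ [Gen_p, Gen_q] @ [Gen_p]) = h ([Gen_q] @ [] @ [Gen_p])"
      by (simp only: h2 h(3))
    then show ?thesis using h2[of "[Gen_q, Gen_p]" "[Gen_q, Gen_p]"] by simp
  qed
  ultimately show ?thesis
    using that[of "h [Gen_q, Gen_p]" "h []"] h(1,4) by blast
qed

text \<open>The set \<open>{x. x - i d \<in> D}\<close> is \<open>D + i d\<close>. With \<open>D\<close> the domain of the identity, the relations
  \<open>PQ = 1\<close>, \<open>Q = 1 Q = Q 1\<close> and \<open>P = 1 P\<close> force \<open>P\<close> and \<open>Q\<close> to be the mutually inverse translations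
  between \<open>D\<close> and \<open>D + d \<subseteq> D\<close>. Prefixing \<open>P\<close> or \<open>Q\<close> to a word then changes \<open>i\<close> by at most one, which
  describes all elements without recourse to normal forms.\<close>

lemma bicyclic_subsemigroup_structure:
  assumes "bicyclic_subsemigroup S IN_inf"
  obtains d D where "0 < d" "shiftable 0 D"
    "\<forall>a\<in>S. 
      \<exists>k i. shiftable k {x. x - int i * d \<in> D} \<and> a = ptrans k {x. x - int i * d \<in> D}"
proof -
  obtain h where range: "range h = S" and mult: "\<forall>u v. h (u @ v) = h u \<otimes>\<^bsub>IN_inf\<^esub> h v"
    and pq: "h [Gen_p, Gen_q] = h []" and qp: "h [Gen_q, Gen_p] \<noteq> h []"
    using assms by (rule bicyclic_subsemigroup_generators)
  note h = range mult[rule_format]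
  have carrier: "h w \<in> carrier IN_inf" for w
    using assms h(1) by (auto simp: bicyclic_subsemigroup_def subsemigroup_def)
  obtain k0 D where e: "shiftable k0 D" "h [] = ptrans k0 D"
    using carrier by (rule carrier_ptransE)
  obtain d A where p: "shiftable d A" "h [Gen_p] = ptrans d A"
    using carrier by (rule carrier_ptransE)
  obtain l B where q: "shiftable l B" "h [Gen_q] = ptrans l B"
    using carrier by (rule carrier_ptransE)
  (* The equations among e, P and Q, read off as equations of translations and of domains. *)
  have product: "k3 = k1 + k2 \<and> D3 = {x \<in> D1. x + k1 \<in> D2}"
    if "h (u @ v) = ptrans k3 D3" "h u = ptrans k1 D1" "h v = ptrans k2 D2"
      "shiftable k1 D1" "shiftable k2 D2" "shiftable k3 D3" for u v k1 k2 k3 D1 D2 D3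
  proof -
    have "ptrans k3 D3 = ptrans (k1 + k2) {x \<in> D1. x + k1 \<in> D2}"
      using that(1-3) h(2)[of u v] ptrans_mult[OF that(4)] by simp
    then show ?thesis
      using ptrans_inject[OF that(6) shiftable_mult[OF that(4,5)]] by simp
  qed
  have k0: "k0 = 0" using product[of "[]" "[]", OF _ e(2) e(2) e(1) e(1) e(1)] e(2) by simp
  have ep: "A = {x \<in> D. x \<in> A}"
    using product[of "[]" "[Gen_p]", OF _ e(2) p(2) e(1) p(1) p(1)] p(2) k0 by simp
  have eq: "B = {x \<in> D. x \<in> B}"
    using product[of "[]" "[Gen_q]", OF _ e(2) q(2) e(1) q(1) q(1)] q(2) k0 by simp
  have qe: "B = {x \<in> B. x + l \<in> D}"
    using product[of "[Gen_q]" "[]", OF _ q(2) e(2) q(1) e(1) q(1)] q(2) by simp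
  have pq': "0 = d + l \<and> D = {x \<in> A. x + d \<in> B}"
    using product[of "[Gen_p]" "[Gen_q]", OF _ p(2) q(2) p(1) q(1) e(1)] pq e(2) k0 by simp
  have l: "l = - d" using pq' by simp
  have AD: "A = D" using ep pq' by blast
  have DB: "x + d \<in> B" if "x \<in> D" for x using pq' that by blast
  have BD: "x - d \<in> D" "x \<in> D" if "x \<in> B" for x using qe eq l that by auto
  have B: "B = {x. x - d \<in> D}" using DB BD by force
  have "B \<noteq> D"
  proof
    assume "B = D"
    then have "{x \<in> B. x + l \<in> A} = D" using qe AD by simp
    moreover have "h [Gen_q, Gen_p] = ptrans (l + d) {x \<in> B. x + l \<in> A}"
      using h(2)[of "[Gen_q]" "[Gen_p]"] p(2) q(2) ptrans_mult[OF q(1)] by simp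
    ultimately show False using qp e(2) k0 l by simp
  qed
  have D: "D \<subseteq> {1..}" using e(1) by (simp add: shiftable_def)
  have "0 < d"
  proof (rule ccontr)
    assume "\<not> 0 < d"
    moreover have "d \<noteq> 0" using B \<open>B \<noteq> D\<close> by auto
    ultimately have "d < 0" by simp
    (* Otherwise translation by d would carry each point of D to a smaller one, forever. *)
    have empty: "x \<notin> D" if "x < int n" for n x
      using that
    proof (induction n arbitrary: x)
      case 0
      then show ?case using D by auto
    next
      case (Suc n)
      then have "x + d \<notin> D" using \<open>d < 0\<close> by auto
      then show ?case using DB BD(2) by blast
    qed
    obtain m where "{m..} \<subseteq> D" using e(1) by (auto simp: shiftable_def)
    then have "m \<in> D" by auto
    moreover have "m < int (nat m + 1)" by simp
    ultimately show False using empty by blast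
  qed
  have shifted: "\<exists>k i. shiftable k {x. x - int i * d \<in> D} \<and> h w = ptrans k {x. x - int i * d \<in> D}" for w
  proof (induction w)
    case Nil
    show ?case using e by (intro exI[of _ k0] exI[of _ 0]) simp
  next
    case (Cons g w)
    then obtain k i where sh: "shiftable k {x. x - int i * d \<in> D}"
      and w: "h w = ptrans k {x. x - int i * d \<in> D}" by blast
    have down: "x - int j * d \<in> D \<Longrightarrow> x \<in> D" for x j
    proof (induction j)
      case (Suc j)
      have "x - int (Suc j) * d + d \<in> D" using DB BD(2) Suc(2) by blast
      then show ?case using Suc(1) by (simp add: algebra_simps)
    qed simp
    show ?case
    proof (cases g)
      case Gen_p
      (* For i = 0 the truncated i - 1 is again 0: the domain D cannot grow. *)
      have "h (g # w) = ptrans (d + k) {x \<in> D. x + d - int i * d \<in> D}"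
        using h(2)[of "[Gen_p]" w] Gen_p p w ptrans_mult[OF p(1)] AD by simp
      moreover have "{x \<in> D. x + d - int i * d \<in> D} = {x. x - int (i - 1) * d \<in> D}"
      proof (cases i)
        case 0
        then show ?thesis using DB BD(2) by auto
      next
        case (Suc j)
        have "x + d - int (Suc j) * d = x - int j * d" for x by (simp add: algebra_simps)
        then have "{x \<in> D. x + d - int (Suc j) * d \<in> D} = {x \<in> D. x - int j * d \<in> D}"
          by presburger
        also have "\<dots> = {x. x - int j * d \<in> D}" using down by blast
        finally have "{x \<in> D. x + d - int (Suc j) * d \<in> D} = {x. x - int j * d \<in> D}" .
        then show ?thesis using Suc by simp
      qed
      moreover have "shiftable (d + k) {x \<in> D. x + d - int i * d \<in> D}"
        using shiftable_mult[OF p(1) sh] AD by simp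
      ultimately show ?thesis by metis
    next
      case Gen_q
      have "h (g # w) = ptrans (l + k) {x \<in> B. x - d - int i * d \<in> D}"
        using h(2)[of "[Gen_q]" w] Gen_q q w ptrans_mult[OF q(1)] l by simp
      moreover have "{x \<in> B. x - d - int i * d \<in> D} = {x. x - int (Suc i) * d \<in> D}"
        using down[of "_ - d" i] B by (auto simp: algebra_simps)
      moreover have "shiftable (l + k) {x \<in> B. x - d - int i * d \<in> D}"
        using shiftable_mult[OF q(1) sh] l by simp
      ultimately show ?thesis by metis
    qed
  qed
  show ?thesis
  proof (rule that[OF \<open>0 < d\<close>])
    show "shiftable 0 D" using e(1) k0 by simp
    show "\<forall>a\<in>S.
        \<exists>k i. shiftable k {x. x - int i * d \<in> D} \<and> a = ptrans k {x. x - int i * d \<in> D}"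
      using shifted h(1) by blast
  qed
qed

lemma shiftable_last_gap:
  assumes "shiftable k D"
  obtains m where "0 \<le> m" "m \<notin> D" "{m + 1..} \<subseteq> D"
proof -
  obtain m where m: "0 \<le> m" "{m..} \<subseteq> D" using assms by (rule shiftable_cofinal)
  then have ex: "{int (nat m) + 1..} \<subseteq> D" by auto
  define n where "n = (LEAST n. {int n + 1..} \<subseteq> D)"
  have n: "{int n + 1..} \<subseteq> D" unfolding n_def using ex by (rule LeastI)
  have "int n \<notin> D"
  proof
    assume nD: "int n \<in> D"
    then have "0 < n" using assms by (auto simp: shiftable_def)
    have "x \<in> D" if "int (n - 1) + 1 \<le> x" for x
      using that nD n \<open>0 < n\<close> by (cases "x = int n") auto
    then have "{int (n - 1) + 1..} \<subseteq> D" by auto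
    then have "n \<le> n - 1" unfolding n_def by (rule Least_le)
    then show False using \<open>0 < n\<close> by simp
  qed
  then show ?thesis using that[of "int n"] n by simp
qed

text \<open>Elements with the same translation differ in \<open>i\<close>; undoing the translation leaves equivalent
  idempotents on \<open>D + i d\<close> and \<open>D + j d\<close> with \<open>i < j\<close>. The last gap of the latter is beyond that of the
  former, as \<open>group_congruence_if_gap\<close> requires.\<close>

lemma group_congruence_if_bicyclic_collapse:
  assumes C: "congruence_on IN_inf C" and S: "bicyclic_subsemigroup S IN_inf"
    and ab: "a \<in> S" "b \<in> S" "a \<noteq> b" "(a, b) \<in> C"
  shows "group_congruence IN_inf C"
proof -
  obtain d D where d: "0 < d" and D: "shiftable 0 D"
    and elem: "\<forall>a\<in>S.
      \<exists>k i. shiftable k {x. x - int i * d \<in> D} \<and> a = ptrans k {x. x - int i * d \<in> D}"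
    using S by (rule bicyclic_subsemigroup_structure)
  let ?D = "\<lambda>i. {x. x - int i * d \<in> D}"
  have main: "group_congruence IN_inf C"
    if "i < j" and sh: "shiftable k (?D i)" "shiftable k (?D j)"
      and DD: "(ptrans k (?D i), ptrans k (?D j)) \<in> C" for k i j
  proof -
    let ?v = "ptrans (- k) {max 1 (k + 1)..}"
    have restrict: "ptrans k E \<otimes>\<^bsub>IN_inf\<^esub> ?v = ptrans 0 E" "shiftable 0 E"
      if E: "shiftable k E" for E
    proof -
      have "{x \<in> E. x + k \<in> {max 1 (k + 1)..}} = E" using E by (auto simp: shiftable_def)
      then show "ptrans k E \<otimes>\<^bsub>IN_inf\<^esub> ?v = ptrans 0 E"
        using ptrans_mult[OF E, of "- k" "{max 1 (k + 1)..}"] by simp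
      show "shiftable 0 E" using E by (auto simp: shiftable_def)
    qed
    have "?v \<in> carrier IN_inf" by (intro ptrans_carrier shiftable_atLeast) auto
    then have "(ptrans k (?D i) \<otimes>\<^bsub>IN_inf\<^esub> ?v, ptrans k (?D j) \<otimes>\<^bsub>IN_inf\<^esub> ?v) \<in> C"
      by (intro congruence_on_mult[OF C DD] congruence_on_refl[OF C])
    then have idem: "(ptrans 0 (?D i), ptrans 0 (?D j)) \<in> C" using sh by (simp add: restrict)
    obtain m where m: "0 \<le> m" "m \<notin> ?D i" "{m + 1..} \<subseteq> ?D i"
      using sh(1) by (rule shiftable_last_gap)
    (* The last gap of D + j d. Since 0 counts as a gap, it exists even for the whole half-line. *)
    define x where "x = m + (int j - int i) * d"
    have "0 < (int j - int i) * d"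
      using \<open>i < j\<close> d by (intro mult_pos_pos) simp_all
    then have "m + 1 \<le> x" by (simp add: x_def)
    then have x: "1 \<le> x" "{x..} \<subseteq> {m + 1..}" using m(1) by auto
    have "{x..} \<subseteq> ?D i" using x(2) m(3) by (rule subset_trans)
    moreover have "x \<notin> ?D j" using m(2) by (simp add: x_def algebra_simps)
    ultimately show ?thesis
      by (rule group_congruence_if_gap[OF C idem restrict(2)[OF sh(1)] restrict(2)[OF sh(2)] x(1)])
  qed
  obtain k i where a: "shiftable k (?D i)" "a = ptrans k (?D i)" using elem ab(1) by blast
  obtain l j where b: "shiftable l (?D j)" "b = ptrans l (?D j)" using elem ab(2) by blast
  consider "k \<noteq> l" | "k = l" "i < j" | "k = l" "j < i"
    using ab(3) a(2) b(2) by (metis linorder_neqE_nat)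
  then show ?thesis
  proof cases
    case 1
    then show ?thesis
      using group_congruence_if_distinct_shift[OF C _ a(1) b(1)] ab(4) a(2) b(2) by blast
  next
    case 2
    then show ?thesis using main[of i j l] a b ab(4) by blast
  next
    case 3
    then show ?thesis using main[of j i l] a b congruence_on_sym[OF C ab(4)] by blast
  qed
qed

theorem mainTheorem7:
  fixes C :: "((nat \<rightharpoonup> nat) \<times> (nat \<rightharpoonup> nat)) set"
  assumes "congruence_on IN_inf C"
  shows "(group_congruence IN_inf C \<longleftrightarrow>
            (\<exists>S. bicyclic_subsemigroup S IN_inf \<and>
                 (\<exists>a\<in>S. \<exists>b\<in>S. a \<noteq> b \<and> (a, b) \<in> C)))
       \<and> ((\<exists>S. bicyclic_subsemigroup S IN_inf \<and>
                 (\<exists>a\<in>S. \<exists>b\<in>S. a \<noteq> b \<and> (a, b) \<in> C)) \<longleftrightarrow>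
            (\<forall>T. bicyclic_subsemigroup T IN_inf \<longrightarrow>
                 (\<exists>a\<in>T. \<exists>b\<in>T. a \<noteq> b \<and> (a, b) \<in> C)))"
  (is "(?group \<longleftrightarrow> ?some) \<and> (?some \<longleftrightarrow> ?every)")
proof -
  have "?every" if ?group
  proof (intro allI impI)
    fix T :: "(nat \<rightharpoonup> nat) set"
    assume T: "bicyclic_subsemigroup T IN_inf"
    then obtain e f where ef: "e \<in> T" "f \<in> T" "e \<noteq> f"
      "e \<otimes>\<^bsub>IN_inf\<^esub> e = e" "f \<otimes>\<^bsub>IN_inf\<^esub> f = f"
      by (rule bicyclic_subsemigroup_idempotents)
    have "T \<subseteq> carrier IN_inf"
      using T by (auto simp: bicyclic_subsemigroup_def subsemigroup_def)
    then have "(e, \<one>\<^bsub>IN_inf\<^esub>) \<in> C" "(f, \<one>\<^bsub>IN_inf\<^esub>) \<in> C"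
      using group_congruence_idempotent[OF monoid_IN_inf that] ef by auto
    then have "(e, f) \<in> C"
      using congruence_on_trans[OF assms _ congruence_on_sym[OF assms]] by blast
    then show "\<exists>a\<in>T. \<exists>b\<in>T. a \<noteq> b \<and> (a, b) \<in> C" using ef(1-3) by blast
  qed
  moreover have ?some if ?every
    using that bicyclic_subsemigroup_exists by blast
  moreover have ?group if ?some
    using that group_congruence_if_bicyclic_collapse[OF assms] by blast
  ultimately show ?thesis by argo
qed

end
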